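(* Let $M$ be a reduced root-closed inside factorial monoid with base $Q$. Then $$M=\bigcup_{a\in \mathrm{Ap}(M,Q)} \bigl(a+\langle Q\rangle\bigr),$$ and this union is disjoint (that is, $(a+\langle Q\rangle)\cap(b+\langle Q\rangle)=\emptyset$ for distinct $a,b\in\mathrm{Ap}(M,Q)$).
   Context: Monoids are commutative, cancellative and written additively; $\mathbb{N}=\{0,1,2,\dots\}$. A monoid $M$ is reduced if its only unit is $0$. For a subset $Q\subseteq M$, $\langle Q\rangle$ denotes the submonoid generated by $Q$. A reduced monoid $M$ is inside factorial with base (Cale basis) $Q$, where $Q$ is a set of nonzero elements of $M$, if (i) for each $x\in M$ there is a positive integer $n(x)$ with $n(x)x\in\langle Q\rangle$, and (ii) whenever $\sum_{q\in Q}\lambda_q q=\sum_{q\in Q}\mu_q q$ with $\lambda_q,\mu_q\in\mathbb{N}$, all but finitely many zero, then $\lambda_q=\mu_q$ for all $q\in Q$. Let $\mathrm{G}(M)$ be the quotient group of $M$ (with $M\subseteq \mathrm{G}(M)$). $M$ is root-closed if whenever $nz\in M$ for some positive integer $n$ and some $z\in\mathrm{G}(M)$, then $z\in M$. The Apéry set of $M$ with respect to $Q$ is $\mathrm{Ap}(M,Q)=M\setminus(Q+M)$, where $Q+M=\{q+x : q\in Q,\ x\in M\}$. *)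

theory Defs
  imports "HOL-Library.Disjoint_Sets"
begin

text \<open>
  The monoid \<open>M\<close> is the universe of a type of class \<^class>\<open>cancel_comm_monoid_add\<close>.
\<close>

primrec nmult :: "nat \<Rightarrow> 'a::monoid_add \<Rightarrow> 'a" where
  "nmult 0 x = 0"
| "nmult (Suc n) x = x + nmult n x"

inductive_set submonoid_gen :: "'a::monoid_add set \<Rightarrow> 'a set" for Q :: "'a set" where
  zero: "0 \<in> submonoid_gen Q"
| gen: "q \<in> Q \<Longrightarrow> q \<in> submonoid_gen Q"
| add: "x \<in> submonoid_gen Q \<Longrightarrow> y \<in> submonoid_gen Q \<Longrightarrow> x + y \<in> submonoid_gen Q"

definition reduced :: "'a::comm_monoid_add itself \<Rightarrow> bool" where
  "reduced _ \<longleftrightarrow> (\<forall>x y :: 'a. x + y = 0 \<longrightarrow> x = 0)"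

text \<open>The pair \<open>(a, b)\<close> represents the formal difference \<open>a - b\<close>.\<close>

definition diff_rel :: "'a::cancel_comm_monoid_add \<times> 'a \<Rightarrow> 'a \<times> 'a \<Rightarrow> bool" where
  "diff_rel p r \<longleftrightarrow> fst p + snd r = fst r + snd p"

lemma equivp_diff_rel: "equivp (diff_rel :: 'a::cancel_comm_monoid_add \<times> 'a \<Rightarrow> _)"
proof (rule equivpI)
  show "reflp (diff_rel :: 'a \<times> 'a \<Rightarrow> _)"
    by (simp add: reflp_def diff_rel_def)
  show "symp (diff_rel :: 'a \<times> 'a \<Rightarrow> _)"
    by (simp add: symp_def diff_rel_def)
  show "transp (diff_rel :: 'a \<times> 'a \<Rightarrow> _)"
  proof (rule transpI)
    fix p r s :: "'a \<times> 'a"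
    assume "diff_rel p r" and "diff_rel r s"
    then have 1: "fst p + snd r = fst r + snd p" and 2: "fst r + snd s = fst s + snd r"
      by (simp_all add: diff_rel_def)
    have "snd r + (fst p + snd s) = (fst p + snd r) + snd s"
      by (simp add: ac_simps)
    also have "\<dots> = (fst r + snd s) + snd p"
      by (simp add: 1 ac_simps)
    also have "\<dots> = snd r + (fst s + snd p)"
      by (simp add: 2 ac_simps)
    finally show "diff_rel p s"
      by (simp add: diff_rel_def)
  qed
qed

quotient_type (overloaded) 'a quotient_group =
  "'a::cancel_comm_monoid_add \<times> 'a" / diff_rel
  by (rule equivp_diff_rel)

instantiation quotient_group :: (cancel_comm_monoid_add) ab_group_add
begin

lift_definition zero_quotient_group :: "'a quotient_group" is "(0, 0)" .

lift_definition plus_quotient_group ::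
    "'a quotient_group \<Rightarrow> 'a quotient_group \<Rightarrow> 'a quotient_group"
  is "\<lambda>p r. (fst p + fst r, snd p + snd r)"
proof -
  fix p p' r r' :: "'a \<times> 'a"
  assume "diff_rel p p'" and "diff_rel r r'"
  then have 1: "fst p + snd p' = fst p' + snd p" and 2: "fst r + snd r' = fst r' + snd r"
    by (simp_all add: diff_rel_def)
  have "(fst p + fst r) + (snd p' + snd r') = (fst p + snd p') + (fst r + snd r')"
    by (simp add: ac_simps)
  also have "\<dots> = (fst p' + fst r') + (snd p + snd r)"
    unfolding 1 2 by (simp add: ac_simps)
  finally show "diff_rel (fst p + fst r, snd p + snd r) (fst p' + fst r', snd p' + snd r')"
    by (simp add: diff_rel_def)
qed

lift_definition uminus_quotient_group :: "'a quotient_group \<Rightarrow> 'a quotient_group"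
  is "\<lambda>p. (snd p, fst p)"
  by (simp add: diff_rel_def add.commute)

definition minus_quotient_group ::
    "'a quotient_group \<Rightarrow> 'a quotient_group \<Rightarrow> 'a quotient_group" where
  "minus_quotient_group x y = x + - y"

instance
proof
  fix x y z :: "'a quotient_group"
  show "x + y + z = x + (y + z)"
    by transfer (simp add: diff_rel_def ac_simps)
  show "x + y = y + x"
    by transfer (simp add: diff_rel_def ac_simps)
  show "0 + x = x"
    by transfer (simp add: diff_rel_def)
  show "- x + x = 0"
    by transfer (simp add: diff_rel_def ac_simps)
  show "x - y = x + - y"
    by (rule minus_quotient_group_def)
qed

end

lift_definition to_group :: "'a::cancel_comm_monoid_add \<Rightarrow> 'a quotient_group"
  is "\<lambda>x. (x, 0)" .

lemma to_group_zero: "to_group 0 = 0"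
  by transfer (simp add: diff_rel_def)

lemma to_group_add: "to_group (x + y) = to_group x + to_group y"
  by transfer (simp add: diff_rel_def)

lemma to_group_eq_iff: "to_group x = to_group y \<longleftrightarrow> x = y"
  by transfer (simp add: diff_rel_def)

lemma to_group_nmult: "to_group (nmult n x) = nmult n (to_group x)"
  by (induction n) (simp_all add: to_group_zero to_group_add)

lemma quotient_group_eq_diff:
  obtains x y where "z = to_group x - to_group y"
proof -
  have "\<exists>x y. z = to_group x + - to_group y"
    by transfer (auto simp add: diff_rel_def)
  then show thesis
    using that by auto
qed

definition root_closed :: "'a::cancel_comm_monoid_add itself \<Rightarrow> bool" where
  "root_closed _ \<longleftrightarrow>
    (\<forall>(z :: 'a quotient_group) n. n > 0 \<longrightarrow> nmult n z \<in> range to_group \<longrightarrow> z \<in> range to_group)"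

definition cale_basis :: "'a::cancel_comm_monoid_add set \<Rightarrow> bool" where
  "cale_basis Q \<longleftrightarrow>
    0 \<notin> Q \<and>
    (\<forall>x. \<exists>n>0. nmult n x \<in> submonoid_gen Q) \<and>
    (\<forall>l m :: 'a \<Rightarrow> nat.
      finite {q \<in> Q. l q \<noteq> 0} \<longrightarrow> finite {q \<in> Q. m q \<noteq> 0} \<longrightarrow>
      (\<Sum>q\<in>{q \<in> Q. l q \<noteq> 0}. nmult (l q) q) = (\<Sum>q\<in>{q \<in> Q. m q \<noteq> 0}. nmult (m q) q) \<longrightarrow>
      (\<forall>q\<in>Q. l q = m q))"

definition apery_set :: "'a::comm_monoid_add set \<Rightarrow> 'a set" where
  "apery_set Q = UNIV - {q + x | q x. q \<in> Q}"

end

theory Submission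
  imports Defs "HOL-Library.Multiset"
begin

text \<open>
  Elements of \<open>\<langle>Q\<rangle>\<close> are sums of finite multisets over \<open>Q\<close>, and condition (ii) on a Cale basis
  says that the multiset is determined by its sum. This allows sizes and multiplicities to be
  compared after passing to a multiple that lies in \<open>\<langle>Q\<rangle>\<close>.

  \<^emph>\<open>Covering.\<close> If \<open>x\<close> is the sum of a multiset \<open>B\<close> over \<open>Q\<close> plus a remainder \<open>y\<close>, then the
  factorization of a multiple of \<open>x\<close> bounds the size of \<open>B\<close> (\<open>bounded_extraction\<close>). For a \<open>B\<close> of
  greatest size the remainder admits no further summand from \<open>Q\<close>, so it lies in the Apery set.

  \<^emph>\<open>Disjointness.\<close> Suppose \<open>a + s = b + t\<close> with \<open>s, t \<in> \<langle>Q\<rangle>\<close>, and that some \<open>q \<in> Q\<close> occurs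
  more often in \<open>s\<close> than in \<open>t\<close>. Multiply by some \<open>n > 0\<close> such that both \<open>n a\<close> and \<open>n b\<close> are in
  \<open>\<langle>Q\<rangle>\<close>. By uniqueness, \<open>n b\<close> contains \<open>q\<close> at least \<open>n\<close> times, so \<open>n (b - q)\<close> is in the monoid and
  root-closedness gives \<open>b \<in> q + M\<close>. Hence for \<open>b\<close> in the Apery set \<open>s\<close> divides \<open>t\<close>
  (\<open>apery_subset_mset\<close>); if \<open>a\<close> is in it as well, then \<open>s = t\<close> by symmetry, and \<open>a = b\<close> by
  cancellation.
\<close>

section \<open>Multiples and multiset sums\<close>

lemma nmult_add_left: "nmult (m + n) x = nmult m x + nmult n (x :: 'a::comm_monoid_add)"
  by (induction m) (simp_all add: ac_simps)

lemma nmult_add_right: "nmult n (x + y) = nmult n x + nmult n (y :: 'a::comm_monoid_add)"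
  by (induction n) (simp_all add: ac_simps)

lemma nmult_mult: "nmult (m * n) x = nmult m (nmult n (x :: 'a::comm_monoid_add))"
  by (induction m) (simp_all add: nmult_add_left)

lemma sum_mset_repeat_mset: "sum_mset (repeat_mset n A) = nmult n (sum_mset A)"
  by (induction n) simp_all

lemma sum_mset_replicate_mset_nmult: "sum_mset (replicate_mset n x) = nmult n x"
  by (induction n) simp_all

lemma set_mset_repeat_mset_subset: "set_mset A \<subseteq> Q \<Longrightarrow> set_mset (repeat_mset n A) \<subseteq> Q"
  by (induction n) auto

text \<open>
  This translates between multisets and families of coefficients with finite support, the form in
  which uniqueness is stated for a Cale basis.
\<close>

lemma sum_mset_eq_sum_nmult:
  "sum_mset A = (\<Sum>x\<in>set_mset A. nmult (count A x) (x :: 'a::comm_monoid_add))"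
proof (induction A)
  case (add y A)
  have "(\<Sum>x\<in>set_mset (add_mset y A). nmult (count (add_mset y A) x) x)
      = (\<Sum>x\<in>insert y (set_mset A). (if x = y then y else 0) + nmult (count A x) x)"
    by (intro sum.cong) auto
  also have "\<dots> = y + (\<Sum>x\<in>insert y (set_mset A). nmult (count A x) x)"
    by (simp add: sum.distrib)
  also have "(\<Sum>x\<in>insert y (set_mset A). nmult (count A x) x)
      = (\<Sum>x\<in>set_mset A. nmult (count A x) x)"
    by (rule sum.mono_neutral_right) (auto simp: not_in_iff)
  finally show ?case
    using add.IH by simp
qed simp

section \<open>Multisets as coordinates with respect to a Cale basis\<close>

lemma submonoid_gen_iff_sum_mset:
  fixes x :: "'a::comm_monoid_add"
  shows "x \<in> submonoid_gen Q \<longleftrightarrow> (\<exists>A. set_mset A \<subseteq> Q \<and> x = sum_mset A)"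
proof
  assume "x \<in> submonoid_gen Q"
  then show "\<exists>A. set_mset A \<subseteq> Q \<and> x = sum_mset A"
  proof induction
    case zero
    show ?case by (rule exI[of _ "{#}"]) simp
  next
    case (gen q)
    then show ?case by (intro exI[of _ "{#q#}"]) simp
  next
    case (add x y)
    then obtain A B where "set_mset A \<subseteq> Q" "x = sum_mset A" "set_mset B \<subseteq> Q" "y = sum_mset B"
      by blast
    then show ?case by (intro exI[of _ "A + B"]) simp
  qed
next
  have "sum_mset A \<in> submonoid_gen Q" if "set_mset A \<subseteq> Q" for A
    using that by (induction A) (auto intro: submonoid_gen.intros)
  then show "x \<in> submonoid_gen Q" if "\<exists>A. set_mset A \<subseteq> Q \<and> x = sum_mset A"
    using that by blast
qed

lemma cale_basis_sum_mset_inject: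
  assumes "cale_basis Q" and A: "set_mset A \<subseteq> Q" and B: "set_mset B \<subseteq> Q"
    and eq: "sum_mset A = sum_mset B"
  shows "A = B"
proof -
  have supp: "{q \<in> Q. count C q \<noteq> 0} = set_mset C" if "set_mset C \<subseteq> Q" for C
    using that by (auto simp: count_eq_zero_iff)
  have "(\<Sum>q\<in>{q \<in> Q. count A q \<noteq> 0}. nmult (count A q) q)
      = (\<Sum>q\<in>{q \<in> Q. count B q \<noteq> 0}. nmult (count B q) q)"
    unfolding supp[OF A] supp[OF B] using eq by (simp only: sum_mset_eq_sum_nmult)
  moreover have "finite {q \<in> Q. count A q \<noteq> 0}" "finite {q \<in> Q. count B q \<noteq> 0}"
    unfolding supp[OF A] supp[OF B] by simp_all
  ultimately have "\<forall>q\<in>Q. count A q = count B q"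
    using assms(1) unfolding cale_basis_def by blast
  moreover have "count A q = count B q" if "q \<notin> Q" for q
    using that A B by (metis not_in_iff subsetD)
  ultimately show ?thesis
    by (blast intro: multiset_eqI)
qed

lemma cale_basis_multiple:
  assumes "cale_basis Q"
  obtains n A where "n > 0" "set_mset A \<subseteq> Q" "nmult n x = sum_mset A"
proof -
  obtain n where "n > 0" "nmult n x \<in> submonoid_gen Q"
    using assms unfolding cale_basis_def by blast
  then show thesis
    using that by (auto simp: submonoid_gen_iff_sum_mset)
qed

section \<open>The covering\<close>

text \<open>
  Size is additive on factorizations, and a multiple of the remainder \<open>y\<close> contributes a nonnegative
  amount. So \<open>n\<close> copies of \<open>B\<close> cannot be larger than the factorization \<open>A\<close> of \<open>n x\<close>; the size of \<open>A\<close>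
  serves as the bound, and it depends on \<open>x\<close> alone.
\<close>

lemma bounded_extraction:
  assumes Q: "cale_basis Q"
  shows "\<exists>N. \<forall>B y. set_mset B \<subseteq> Q \<longrightarrow> x = sum_mset B + y \<longrightarrow> size B \<le> N"
proof -
  obtain n A where n: "n > 0" and A: "set_mset A \<subseteq> Q" "nmult n x = sum_mset A"
    using cale_basis_multiple[OF Q] .
  have "size B \<le> size A" if B: "set_mset B \<subseteq> Q" and x: "x = sum_mset B + y" for B y
  proof -
    obtain k C where k: "k > 0" and C: "set_mset C \<subseteq> Q" "nmult k y = sum_mset C"
      using cale_basis_multiple[OF Q] .
    have "sum_mset (repeat_mset k A) = nmult (n * k) x"
      by (simp add: sum_mset_repeat_mset A(2)[symmetric] nmult_mult[symmetric] mult.commute)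
    also have "\<dots> = sum_mset (repeat_mset (n * k) B + repeat_mset n C)"
      by (simp add: sum_mset_repeat_mset x nmult_add_right C(2)[symmetric] nmult_mult)
    finally have "repeat_mset k A = repeat_mset (n * k) B + repeat_mset n C"
      using A(1) B C(1)
      by (intro cale_basis_sum_mset_inject[OF Q]) (simp_all add: set_mset_repeat_mset_subset)
    then have "k * size A = n * k * size B + n * size C"
      by (metis size_repeat_mset size_union)
    moreover have "k * size B \<le> n * k * size B"
      using n by simp
    ultimately have "k * size B \<le> k * size A"
      by linarith
    then show ?thesis
      using k by simp
  qed
  then show ?thesis by blast
qed

lemma apery_decomposition:
  assumes "cale_basis Q"
  shows "\<exists>a\<in>apery_set Q. \<exists>s\<in>submonoid_gen Q. x = a + s"
proof -
  define P where "P B \<longleftrightarrow> set_mset B \<subseteq> Q \<and> (\<exists>y. x = sum_mset B + y)" for B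
  obtain N where N: "\<And>B. P B \<Longrightarrow> size B \<le> N"
    using bounded_extraction[OF assms, of x] unfolding P_def by blast
  have "P {#}"
    by (simp add: P_def)
  then obtain B where B: "P B" and max: "\<And>C. P C \<Longrightarrow> size C \<le> size B"
    using ex_has_greatest_nat[of P "{#}" size "N + 1"] N by (metis less_Suc_eq_le Suc_eq_plus1)
  then obtain a where a: "x = sum_mset B + a"
    by (auto simp: P_def)
  have "a \<in> apery_set Q"
  proof (rule ccontr)
    assume "a \<notin> apery_set Q"
    then obtain q y where "q \<in> Q" "a = q + y"
      by (auto simp: apery_set_def)
    then have "P (add_mset q B)"
      using B a unfolding P_def by (intro conjI exI[of _ y]) (simp_all add: ac_simps)
    then show False
      using max by fastforce
  qed
  moreover have "sum_mset B \<in> submonoid_gen Q"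
    using B by (auto simp: P_def submonoid_gen_iff_sum_mset)
  ultimately show ?thesis
    using a by (auto simp: add.commute)
qed

section \<open>Disjointness\<close>

text \<open>
  Root-closedness is applied to \<open>b - q\<close> in the quotient group, whose \<open>n\<close>-th multiple is \<open>u\<close>.
\<close>

lemma root_closed_cancel_nmult:
  fixes b q u :: "'a::cancel_comm_monoid_add"
  assumes "root_closed TYPE('a)" and "n > 0" and eq: "nmult n b = nmult n q + u"
  shows "\<exists>x. b = q + x"
proof -
  let ?z = "to_group b - to_group q"
  have "nmult n ?z + nmult n (to_group q) = nmult n (to_group b)"
    by (simp add: nmult_add_right[symmetric])
  also have "\<dots> = to_group u + nmult n (to_group q)"
    by (simp add: to_group_nmult[symmetric] eq to_group_add add.commute)
  finally have "nmult n ?z = to_group u"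
    by simp
  then have "?z \<in> range to_group"
    using assms(1,2) unfolding root_closed_def by blast
  then obtain x where "?z = to_group x"
    by blast
  then have "to_group b = to_group (q + x)"
    by (simp add: to_group_add algebra_simps)
  then show ?thesis
    by (auto simp: to_group_eq_iff)
qed

text \<open>
  An excess of \<open>q\<close> in \<open>A\<close> over \<open>B\<close> would have to be compensated on the right by \<open>b\<close>, and
  root-closedness turns this into an honest summand \<open>q\<close> of \<open>b\<close>.
\<close>

lemma apery_subset_mset:
  fixes Q :: "'a::cancel_comm_monoid_add set"
  assumes rc: "root_closed TYPE('a)" and Q: "cale_basis Q" and b: "b \<in> apery_set Q"
    and A: "set_mset A \<subseteq> Q" and B: "set_mset B \<subseteq> Q"
    and eq: "a + sum_mset A = b + sum_mset B"
  shows "A \<subseteq># B"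
proof (rule mset_subset_eqI, rule ccontr)
  fix q assume "\<not> count A q \<le> count B q"
  then have less: "Suc (count B q) \<le> count A q"
    by simp
  then have "q \<in># A"
    by (metis Suc_le_lessD count_inI not_less_zero)
  then have "q \<in> Q"
    using A by blast
  obtain k C where k: "k > 0" and C: "set_mset C \<subseteq> Q" "nmult k a = sum_mset C"
    using cale_basis_multiple[OF Q] .
  obtain m D where m: "m > 0" and D: "set_mset D \<subseteq> Q" "nmult m b = sum_mset D"
    using cale_basis_multiple[OF Q] .
  define n where "n = k * m"
  have na: "nmult n a = sum_mset (repeat_mset m C)"
    by (simp add: n_def mult.commute[of k] nmult_mult C(2) sum_mset_repeat_mset)
  have nb: "nmult n b = sum_mset (repeat_mset k D)"
    by (simp add: n_def nmult_mult D(2) sum_mset_repeat_mset)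
  have "nmult n a + nmult n (sum_mset A) = nmult n b + nmult n (sum_mset B)"
    by (simp add: nmult_add_right[symmetric] eq)
  then have "sum_mset (repeat_mset m C + repeat_mset n A)
      = sum_mset (repeat_mset k D + repeat_mset n B)"
    by (simp add: na nb sum_mset_repeat_mset)
  then have "repeat_mset m C + repeat_mset n A = repeat_mset k D + repeat_mset n B"
    using A B C(1) D(1)
    by (intro cale_basis_sum_mset_inject[OF Q]) (simp_all add: set_mset_repeat_mset_subset)
  then have "count (repeat_mset m C + repeat_mset n A) q
      = count (repeat_mset k D + repeat_mset n B) q"
    by simp
  then have "m * count C q + n * count A q = count (repeat_mset k D) q + n * count B q"
    by simp
  moreover have "n + n * count B q \<le> n * count A q"
    using mult_le_mono2[OF less, of n] by simp
  ultimately have "n \<le> count (repeat_mset k D) q"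
    by linarith
  then have "replicate_mset n q \<subseteq># repeat_mset k D"
    by (simp add: count_le_replicate_mset_subset_eq[symmetric])
  then obtain E where "repeat_mset k D = replicate_mset n q + E"
    by (auto simp: mset_subset_eq_exists_conv)
  then have "nmult n b = nmult n q + sum_mset E"
    using nb by (simp add: sum_mset_replicate_mset_nmult)
  moreover have "n > 0"
    using k m by (simp add: n_def)
  ultimately obtain x where "b = q + x"
    using root_closed_cancel_nmult[OF rc] by blast
  then show False
    using b \<open>q \<in> Q\<close> by (auto simp: apery_set_def)
qed

lemma apery_decomposition_unique:
  fixes Q :: "'a::cancel_comm_monoid_add set"
  assumes "root_closed TYPE('a)" and "cale_basis Q"
    and ab: "a \<in> apery_set Q" "b \<in> apery_set Q"
    and st: "s \<in> submonoid_gen Q" "t \<in> submonoid_gen Q"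
    and eq: "a + s = b + t"
  shows "a = b"
proof -
  obtain A B where A: "set_mset A \<subseteq> Q" "s = sum_mset A" and B: "set_mset B \<subseteq> Q" "t = sum_mset B"
    using st by (auto simp: submonoid_gen_iff_sum_mset)
  have "A \<subseteq># B"
    using apery_subset_mset[OF assms(1,2) ab(2) A(1) B(1)] eq A(2) B(2) by blast
  moreover have "B \<subseteq># A"
    using apery_subset_mset[OF assms(1,2) ab(1) B(1) A(1)] eq A(2) B(2) by metis
  ultimately have "A = B"
    by (rule subset_mset.antisym)
  then show ?thesis
    using eq A(2) B(2) by simp
qed

theorem theorem1:
  fixes Q :: "'a::cancel_comm_monoid_add set"
  assumes "reduced TYPE('a)" and "root_closed TYPE('a)" and "cale_basis Q"
  shows "(UNIV :: 'a set) = (\<Union>a\<in>apery_set Q. (\<lambda>x. a + x) ` submonoid_gen Q) \<and>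
         disjoint_family_on (\<lambda>a. (\<lambda>x. a + x) ` submonoid_gen Q) (apery_set Q)"
proof
  show "(UNIV :: 'a set) = (\<Union>a\<in>apery_set Q. (\<lambda>x. a + x) ` submonoid_gen Q)"
    using apery_decomposition[OF assms(3)] by blast
  show "disjoint_family_on (\<lambda>a. (\<lambda>x. a + x) ` submonoid_gen Q) (apery_set Q)"
    unfolding disjoint_family_on_def
    using apery_decomposition_unique[OF assms(2,3)] by blast
qed

end
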